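(* Let $n\ge1$, let $\mathcal{C}\subset\mathbb{H}^n$ be a convex set, let $f:\mathcal{C}\to\mathbb{R}$ be a real-differentiable function, and let $\sigma>0$. Then $f$ is $\sigma$-strongly convex if and only if for all $\boldsymbol{p},\boldsymbol{q}\in\mathcal{C}$, $$\mathrm{Re}\left\{\big(\nabla_{\boldsymbol{p}^*}f(\boldsymbol{p})-\nabla_{\boldsymbol{q}^*}f(\boldsymbol{q})\big)^{\mathsf{H}}(\boldsymbol{p}-\boldsymbol{q})\right\}\geqslant\frac{\sigma}{4}\|\boldsymbol{p}-\boldsymbol{q}\|_2^2 .$$
   Context: $\mathbb{H}$ is the algebra of real quaternions $q=q_a+q_bi+q_cj+q_dk$ ($i^2=j^2=k^2=ijk=-1$), with $\mathrm{Re}\{q\}=q_a$ and $q^*=q_a-q_bi-q_cj-q_dk$; $(\cdot)^{\mathsf{H}}$ is the conjugate transpose and $\|\boldsymbol{q}\|_2=\sqrt{\boldsymbol{q}^{\mathsf{H}}\boldsymbol{q}}$. A set $\mathcal{C}\subset\mathbb{H}^n$ is convex if $\theta\boldsymbol{x}+(1-\theta)\boldsymbol{y}\in\mathcal{C}$ for all $\boldsymbol{x},\boldsymbol{y}\in\mathcal{C}$, real $0\le\theta\le1$. For $\sigma>0$, $f:\mathcal{C}\to\mathbb{R}$ is $\sigma$-strongly convex if for all $\boldsymbol{p},\boldsymbol{q}\in\mathcal{C}$ and $\theta\in(0,1)$, $f(\theta\boldsymbol{p}+(1-\theta)\boldsymbol{q})\le\theta f(\boldsymbol{p})+(1-\theta)f(\boldsymbol{q})-\frac{\sigma}{2}\theta(1-\theta)\|\boldsymbol{p}-\boldsymbol{q}\|_2^2$.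 Real-differentiable means that $f$, viewed as a function of the $4n$ real components of $\boldsymbol{q}$, is differentiable at every point of $\mathcal{C}$ ($f$ is defined only on $\mathcal{C}$, so partial derivatives at points of $\mathcal{C}$ are the usual two-sided ones computed from values on $\mathcal{C}$). The quaternion gradient is $\nabla_{\boldsymbol{q}^*}f=\left(\frac{\partial f}{\partial q_1^*},\dots,\frac{\partial f}{\partial q_n^*}\right)^{\mathsf{T}}\in\mathbb{H}^n$ with $\frac{\partial f}{\partial q_l^*}=\frac14\left(\frac{\partial f}{\partial q_{l,a}}+\frac{\partial f}{\partial q_{l,b}}i+\frac{\partial f}{\partial q_{l,c}}j+\frac{\partial f}{\partial q_{l,d}}k\right)$, $q_l=q_{l,a}+q_{l,b}i+q_{l,c}j+q_{l,d}k$; $\nabla_{\boldsymbol{p}^*}f(\boldsymbol{p})$ is its value at $\boldsymbol{p}$. *)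

theory Defs
  imports "HOL-Analysis.Analysis"
begin

datatype quat = Quat (qa: real) (qb: real) (qc: real) (qd: real)

lemma quat_eq_iff: "x = y \<longleftrightarrow> qa x = qa y \<and> qb x = qb y \<and> qc x = qc y \<and> qd x = qd y"
  by (cases x; cases y) simp

instantiation quat :: real_vector
begin

definition "0 = Quat 0 0 0 0"
definition "x + y = Quat (qa x + qa y) (qb x + qb y) (qc x + qc y) (qd x + qd y)"
definition "- x = Quat (- qa x) (- qb x) (- qc x) (- qd x)"
definition "(x::quat) - y = Quat (qa x - qa y) (qb x - qb y) (qc x - qc y) (qd x - qd y)"
definition "r *\<^sub>R x = Quat (r * qa x) (r * qb x) (r * qc x) (r * qd x)"

instance
  by standard
    (simp_all add: zero_quat_def plus_quat_def uminus_quat_def minus_quat_def scaleR_quat_def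
      quat_eq_iff algebra_simps)

end

lemma quat_sel_linear [simp]:
  "qa 0 = 0" "qb 0 = 0" "qc 0 = 0" "qd 0 = 0"
  "qa (x + y) = qa x + qa y" "qb (x + y) = qb x + qb y"
  "qc (x + y) = qc x + qc y" "qd (x + y) = qd x + qd y"
  "qa (- x) = - qa x" "qb (- x) = - qb x" "qc (- x) = - qc x" "qd (- x) = - qd x"
  "qa (x - y) = qa x - qa y" "qb (x - y) = qb x - qb y"
  "qc (x - y) = qc x - qc y" "qd (x - y) = qd x - qd y"
  "qa (r *\<^sub>R x) = r * qa x" "qb (r *\<^sub>R x) = r * qb x"
  "qc (r *\<^sub>R x) = r * qc x" "qd (r *\<^sub>R x) = r * qd x"
  by (simp_all add: zero_quat_def plus_quat_def uminus_quat_def minus_quat_def scaleR_quat_def)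

instantiation quat :: real_algebra_1
begin

definition "1 = Quat 1 0 0 0"
definition "x * y = Quat
  (qa x * qa y - qb x * qb y - qc x * qc y - qd x * qd y)
  (qa x * qb y + qb x * qa y + qc x * qd y - qd x * qc y)
  (qa x * qc y - qb x * qd y + qc x * qa y + qd x * qb y)
  (qa x * qd y + qb x * qc y - qc x * qb y + qd x * qa y)"

instance
  by standard (simp_all add: one_quat_def times_quat_def quat_eq_iff algebra_simps)

end

lemma quat_sel_one [simp]: "qa 1 = 1" "qb 1 = 0" "qc 1 = 0" "qd 1 = 0"
  by (simp_all add: one_quat_def)

lemma quat_sel_times [simp]:
  "qa (x * y) = qa x * qa y - qb x * qb y - qc x * qc y - qd x * qd y"
  "qb (x * y) = qa x * qb y + qb x * qa y + qc x * qd y - qd x * qc y"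
  "qc (x * y) = qa x * qc y - qb x * qd y + qc x * qa y + qd x * qb y"
  "qd (x * y) = qa x * qd y + qb x * qc y - qc x * qb y + qd x * qa y"
  by (simp_all add: times_quat_def)

lemma quat_sel_of_real [simp]:
  "qa (of_real r) = r" "qb (of_real r) = 0" "qc (of_real r) = 0" "qd (of_real r) = 0"
  by (simp_all add: of_real_def)

definition qi :: quat where "qi = Quat 0 1 0 0"
definition qj :: quat where "qj = Quat 0 0 1 0"
definition qk :: quat where "qk = Quat 0 0 0 1"

lemma quat_unit_relations:
  "qi * qi = - 1" "qj * qj = - 1" "qk * qk = - 1" "qi * qj * qk = - 1"
  by (simp_all add: quat_eq_iff qi_def qj_def qk_def)

lemma quat_expand:
  "q = of_real (qa q) + of_real (qb q) * qi + of_real (qc q) * qj + of_real (qd q) * qk"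
  by (simp add: quat_eq_iff qi_def qj_def qk_def)

definition qcnj :: "quat \<Rightarrow> quat"
  where "qcnj q = Quat (qa q) (- qb q) (- qc q) (- qd q)"

lemma quat_sel_qcnj [simp]:
  "qa (qcnj q) = qa q" "qb (qcnj q) = - qb q" "qc (qcnj q) = - qc q" "qd (qcnj q) = - qd q"
  by (simp_all add: qcnj_def)

text \<open>
  The Euclidean structure of \<open>\<real>\<^sup>4\<close>; the norm on \<open>quat ^ 'n\<close> then comes from the library,
  and \<open>quat_vec_norm\<close> below identifies it with the norm given by the conjugate transpose.
\<close>

instantiation quat :: real_inner
begin

definition "x \<bullet> y = qa x * qa y + qb x * qb y + qc x * qc y + qd x * qd y"
definition "norm (x::quat) = sqrt (x \<bullet> x)"
definition "dist (x::quat) y = norm (x - y)"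
definition "sgn (x::quat) = x /\<^sub>R norm x"
definition "(uniformity :: (quat \<times> quat) filter) = (INF e\<in>{0 <..}. principal {(x, y). dist x y < e})"
definition "open (U :: quat set) \<longleftrightarrow>
  (\<forall>x\<in>U. eventually (\<lambda>(x', y). x' = x \<longrightarrow> y \<in> U) uniformity)"

instance
proof
  fix x y z :: quat and r :: real
  show "x \<bullet> y = y \<bullet> x" "(x + y) \<bullet> z = x \<bullet> z + y \<bullet> z" "r *\<^sub>R x \<bullet> y = r * (x \<bullet> y)"
    by (simp_all add: inner_quat_def algebra_simps)
  show "0 \<le> x \<bullet> x"
    by (simp add: inner_quat_def)
  show "x \<bullet> x = 0 \<longleftrightarrow> x = 0"
    by (simp add: inner_quat_def quat_eq_iff add_nonneg_eq_0_iff)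
qed (simp_all add: norm_quat_def dist_quat_def sgn_quat_def uniformity_quat_def open_quat_def)

end

instantiation quat :: euclidean_space
begin

definition "Basis = {1, qi, qj, qk}"

instance
proof
  have unit_inner: "x \<bullet> 1 = qa x" "x \<bullet> qi = qb x" "x \<bullet> qj = qc x" "x \<bullet> qk = qd x" for x
    by (simp_all add: inner_quat_def qi_def qj_def qk_def)
  show "(Basis :: quat set) \<noteq> {}" "finite (Basis :: quat set)"
    by (simp_all add: Basis_quat_def)
  show "u \<bullet> v = (if u = v then 1 else 0)" if "u \<in> Basis" "v \<in> Basis" for u v :: quat
    using that unfolding Basis_quat_def
    by (elim insertE emptyE; simp add: unit_inner; simp add: quat_eq_iff qi_def qj_def qk_def)
  show "(\<forall>u\<in>Basis. x \<bullet> u = 0) \<longleftrightarrow> x = 0" for x :: quat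
    by (simp add: Basis_quat_def unit_inner quat_eq_iff[of x 0])
qed

end

definition hprod :: "quat ^ 'n \<Rightarrow> quat ^ 'n \<Rightarrow> quat"  (* u^H v *)
  where "hprod u v = (\<Sum>l\<in>UNIV. qcnj (u $ l) * v $ l)"

lemma hprod_self: "hprod q q = of_real ((norm q)\<^sup>2)"
proof -
  have "qcnj x * x = of_real (x \<bullet> x)" for x :: quat
    by (simp add: quat_eq_iff inner_quat_def)
  then show ?thesis
    by (simp add: hprod_def power2_norm_eq_inner inner_vec_def)
qed

lemma quat_vec_norm: "norm q = sqrt (qa (hprod q q))"
  by (simp add: hprod_self del: of_real_power)

definition strongly_convex_on :: "real \<Rightarrow> (quat ^ 'n) set \<Rightarrow> (quat ^ 'n \<Rightarrow> real) \<Rightarrow> bool"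
  where "strongly_convex_on \<sigma> C f \<longleftrightarrow>
    (\<forall>p\<in>C. \<forall>q\<in>C. \<forall>\<theta>\<in>{0<..<1}.
      f (\<theta> *\<^sub>R p + (1 - \<theta>) *\<^sub>R q)
        \<le> \<theta> * f p + (1 - \<theta>) * f q - \<sigma> / 2 * \<theta> * (1 - \<theta>) * (norm (p - q))\<^sup>2)"

text \<open>
  A function \<open>C \<rightarrow> \<real>\<close> is represented by a total one whose values outside \<open>C\<close> are irrelevant.
  For the two-sided partial derivatives at a point of \<open>C\<close> to be determined by the values on \<open>C\<close>,
  each of the \<open>4n\<close> coordinate lines through the point must stay in \<open>C\<close> near it (for convex \<open>C\<close>
  this says that the point is interior). The differential itself is taken within \<open>C\<close>.
\<close>

definition real_differentiable_on :: "(quat ^ 'n \<Rightarrow> real) \<Rightarrow> (quat ^ 'n) set \<Rightarrow> bool"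
  where "real_differentiable_on f C \<longleftrightarrow>
    (\<forall>p\<in>C. (\<forall>l. \<forall>u\<in>{1, qi, qj, qk}. \<forall>\<^sub>F t in at 0. p + t *\<^sub>R axis l u \<in> C) \<and>
            f differentiable (at p within C))"

text \<open>
  With \<open>u\<close> one of \<open>1, qi, qj, qk\<close>, this is the partial derivative with respect to the real
  component of the \<open>l\<close>-th entry that belongs to \<open>u\<close>.
\<close>

definition quat_partial :: "(quat ^ 'n \<Rightarrow> real) \<Rightarrow> quat ^ 'n \<Rightarrow> 'n \<Rightarrow> quat \<Rightarrow> real"
  where "quat_partial f p l u = deriv (\<lambda>t. f (p + t *\<^sub>R axis l u)) 0"

definition quat_grad :: "(quat ^ 'n \<Rightarrow> real) \<Rightarrow> quat ^ 'n \<Rightarrow> quat ^ 'n"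
  where "quat_grad f p = (\<chi> l. (1 / 4) *\<^sub>R
    (of_real (quat_partial f p l 1) + of_real (quat_partial f p l qi) * qi
      + of_real (quat_partial f p l qj) * qj + of_real (quat_partial f p l qk) * qk))"

end

theory Submission
  imports Defs
begin

text \<open>
  The map \<open>(u, v) \<mapsto> Re (u\<^sup>H v)\<close> is the Euclidean inner product of \<open>\<real>\<^sup>4\<^sup>n\<close>, and in terms of it
  the quaternion gradient represents one quarter of the Frechet derivative: the factor \<open>1/4\<close> in the
  definition of the gradient is exactly what turns the constant \<open>\<sigma>\<close> of the real theory into \<open>\<sigma>/4\<close>
  (\<open>inner_quat_grad\<close>). What remains is the real statement, valid in every normed space
  because only segments matter, that \<open>f\<close> is \<open>\<sigma>\<close>-strongly convex if and only if
  \<open>(D f p - D f q) (p - q) \<ge> \<sigma> \<parallel>p - q\<parallel>\<^sup>2\<close> for all \<open>p, q \<in> C\<close>.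

  If \<open>f\<close> is strongly convex, dividing the defining inequality by \<open>\<theta>\<close> and letting
  \<open>\<theta> \<rightarrow> 0\<close> gives \<open>f q + D f q (p - q) + \<sigma>/2 \<parallel>p - q\<parallel>\<^sup>2 \<le> f p\<close> (\<open>strongly_convex_above_tangent\<close>);
  adding this to the same inequality with \<open>p\<close> and \<open>q\<close> exchanged gives monotonicity. Conversely,
  on the segment from \<open>q\<close> to \<open>p\<close> the function \<open>t \<mapsto> f (q + t (p - q)) - \<sigma>/2 t\<^sup>2 \<parallel>p - q\<parallel>\<^sup>2\<close>
  has a nondecreasing derivative, hence lies below its chord (\<open>below_chord_if_deriv_mono\<close>), and this
  is the inequality of strong convexity (\<open>monotone_imp_strongly_convex\<close>).
\<close>

lemma qa_hprod:
  fixes u v :: "quat ^ 'n"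
  shows "qa (hprod u v) = u \<bullet> v"
proof -
  have "qa (sum g A) = (\<Sum>x\<in>A. qa (g x))" for g :: "'n \<Rightarrow> quat" and A
    by (induction A rule: infinite_finite_induct) simp_all
  then show ?thesis
    by (simp add: hprod_def inner_vec_def inner_quat_def)
qed

text \<open>
  The derivative of \<open>f\<close> is taken within \<open>C\<close>, the partial derivative is two-sided. They
  match because the coordinate line stays in \<open>C\<close> for all parameters in an open set around \<open>0\<close>, on
  which a derivative within the set is an unrestricted one.
\<close>

lemma quat_partial_eq_derivative:
  assumes "(f has_derivative D) (at p within C)" and "p \<in> C"
    and ev: "\<forall>\<^sub>F t in at 0. p + t *\<^sub>R axis l u \<in> C"
  shows "quat_partial f p l u = D (axis l u)"
proof -
  let ?g = "\<lambda>t. p + t *\<^sub>R axis l u"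
  let ?S = "{t. ?g t \<in> C}"
  have "\<forall>\<^sub>F t in nhds 0. t \<in> ?S"
    using ev \<open>p \<in> C\<close> by (simp add: eventually_nhds_conv_at)
  then obtain U where U: "open U" "0 \<in> U" "U \<subseteq> ?S"
    by (auto simp: eventually_nhds)
  have "(?g has_derivative (\<lambda>t. t *\<^sub>R axis l u)) (at 0 within U)"
    by (auto intro!: derivative_eq_intros)
  moreover have "(f has_derivative D) (at (?g 0) within ?g ` U)"
    using assms(1) U by (auto intro: has_derivative_subset)
  ultimately have comp: "((\<lambda>t. f (?g t)) has_derivative (\<lambda>t. D (t *\<^sub>R axis l u))) (at 0 within U)"
    using has_derivative_in_compose by blast
  have "t * D (axis l u) = D (t *\<^sub>R axis l u)" for t
    using linear_scale[OF has_derivative_linear[OF assms(1)]] by simp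
  from has_derivative_imp_has_field_derivative[OF comp this]
  have "((\<lambda>t. f (?g t)) has_real_derivative D (axis l u)) (at 0)"
    by (simp only: at_within_open[OF U(2,1)])
  then show ?thesis
    unfolding quat_partial_def by (rule DERIV_imp_deriv)
qed

text \<open>
  Both sides are linear in \<open>v\<close>, so it suffices to compare them on the real basis of the vectors
  \<open>axis l u\<close>, where the left-hand side is by construction a quarter of a partial derivative.
\<close>

lemma inner_quat_grad:
  fixes f :: "quat ^ 'n \<Rightarrow> real"
  assumes D: "(f has_derivative D) (at p within C)" and "p \<in> C"
    and ev: "\<And>l u. u \<in> {1, qi, qj, qk} \<Longrightarrow> \<forall>\<^sub>F t in at 0. p + t *\<^sub>R axis l u \<in> C"
  shows "quat_grad f p \<bullet> v = D v / 4"
proof -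
  have "(\<lambda>v. 4 * (quat_grad f p \<bullet> v)) = D"
  proof (rule linear_eq_stdbasis)
    show "linear (\<lambda>v. 4 * (quat_grad f p \<bullet> v))"
      by (intro linearI) (simp_all add: inner_add_right distrib_left)
    show "linear D"
      using D by (rule has_derivative_linear)
    fix b :: "quat ^ 'n"
    assume "b \<in> Basis"
    then obtain l u where b: "b = axis l u" and u: "u \<in> {1, qi, qj, qk}"
      by (auto simp: Basis_vec_def Basis_quat_def)
    have "4 * (quat_grad f p \<bullet> b) = quat_partial f p l u"
      using u by (auto simp: b inner_axis quat_grad_def inner_quat_def qi_def qj_def qk_def)
    also have "\<dots> = D b"
      unfolding b by (rule quat_partial_eq_derivative[OF D \<open>p \<in> C\<close> ev[OF u]])
    finally show "4 * (quat_grad f p \<bullet> b) = D b" .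
  qed
  from fun_cong[OF this, of v] show ?thesis
    by simp
qed

lemma segment_in_convex:
  fixes C :: "'a::real_vector set"
  assumes "convex C" "p \<in> C" "q \<in> C" "t \<in> {0..1}"
  shows "q + t *\<^sub>R (p - q) \<in> C"
  using convexD_alt[of C q p t] assms by (simp add: algebra_simps)

lemma has_derivative_on_segment:
  fixes f :: "'a::real_normed_vector \<Rightarrow> real"
  assumes "convex C" "p \<in> C" "q \<in> C" "t \<in> {0..1}"
    and D: "(f has_derivative D) (at (q + t *\<^sub>R (p - q)) within C)"
  shows "((\<lambda>s. f (q + s *\<^sub>R (p - q))) has_real_derivative D (p - q)) (at t within {0..1})"
proof -
  let ?g = "\<lambda>s. q + s *\<^sub>R (p - q)"
  have "(?g has_derivative (\<lambda>s. s *\<^sub>R (p - q))) (at t within {0..1})"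
    by (auto intro!: derivative_eq_intros)
  moreover have "(f has_derivative D) (at (?g t) within ?g ` {0..1})"
    using D segment_in_convex[OF assms(1-3)] by (auto intro: has_derivative_subset)
  ultimately have "((\<lambda>s. f (?g s)) has_derivative (\<lambda>s. D (s *\<^sub>R (p - q)))) (at t within {0..1})"
    using has_derivative_in_compose by blast
  moreover have "linear D"
    using D by (rule has_derivative_linear)
  ultimately show ?thesis
    by (intro has_derivative_imp_has_field_derivative) (simp_all add: linear_scale)
qed

lemma strongly_convex_above_tangent:
  fixes f :: "'a::real_normed_vector \<Rightarrow> real"
  assumes "convex C" "p \<in> C" "q \<in> C" and D: "(f has_derivative D) (at q within C)"
    and sc: "\<And>\<theta>. \<theta> \<in> {0<..<1} \<Longrightarrow> f (\<theta> *\<^sub>R p + (1 - \<theta>) *\<^sub>R q)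
        \<le> \<theta> * f p + (1 - \<theta>) * f q - \<sigma> / 2 * \<theta> * (1 - \<theta>) * (norm (p - q))\<^sup>2"
  shows "f q + D (p - q) + \<sigma> / 2 * (norm (p - q))\<^sup>2 \<le> f p"
proof -
  let ?N = "(norm (p - q))\<^sup>2"
  let ?h = "\<lambda>t. f (q + t *\<^sub>R (p - q))"
  have "(?h has_real_derivative D (p - q)) (at 0 within {0..1})"
    using has_derivative_on_segment[OF assms(1-3), of 0 f D] D by simp
  then have "((\<lambda>t. (?h t - f q) / t) \<longlongrightarrow> D (p - q)) (at 0 within {0..1})"
    by (simp add: has_field_derivative_iff)
  then have lim: "((\<lambda>t. (?h t - f q) / t) \<longlongrightarrow> D (p - q)) (at_right 0)"
    by (simp add: at_within_Icc_at_right)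
  have lim': "((\<lambda>t. f p - f q - \<sigma> / 2 * (1 - t) * ?N) \<longlongrightarrow> f p - f q - \<sigma> / 2 * (1 - 0) * ?N)
      (at_right 0)"
    by (intro tendsto_intros)
  have le: "(?h t - f q) / t \<le> f p - f q - \<sigma> / 2 * (1 - t) * ?N" if "t \<in> {0<..<1}" for t
  proof -
    have "t *\<^sub>R p + (1 - t) *\<^sub>R q = q + t *\<^sub>R (p - q)"
      by (simp add: algebra_simps)
    then have "?h t - f q \<le> t * (f p - f q - \<sigma> / 2 * (1 - t) * ?N)"
      using sc[OF that] by (simp add: algebra_simps)
    then show ?thesis
      using that by (simp add: divide_le_eq mult.commute)
  qed
  have "\<forall>\<^sub>F t in at_right (0::real). t \<in> {0<..<1}"
    by (rule eventually_at_right_real) simp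
  then have "\<forall>\<^sub>F t in at_right 0. (?h t - f q) / t \<le> f p - f q - \<sigma> / 2 * (1 - t) * ?N"
    by (rule eventually_mono) (rule le)
  from tendsto_le[OF trivial_limit_at_right_real lim' lim this]
  have "D (p - q) \<le> f p - f q - \<sigma> / 2 * (1 - 0) * ?N" .
  then show ?thesis
    by simp
qed

text \<open>
  The mean value theorem on \<open>[0, \<theta>]\<close> and on \<open>[\<theta>, 1]\<close> realises the slopes of both parts as
  derivatives at two ordered points, so the left slope is at most the right one.
\<close>

lemma below_chord_if_deriv_mono:
  fixes h h' :: "real \<Rightarrow> real"
  assumes deriv: "\<And>t. t \<in> {0..1} \<Longrightarrow> (h has_real_derivative h' t) (at t within {0..1})"
    and mono: "\<And>s t. 0 < s \<Longrightarrow> s < t \<Longrightarrow> t < 1 \<Longrightarrow> h' s \<le> h' t"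
    and \<theta>: "0 < \<theta>" "\<theta> < 1"
  shows "h \<theta> \<le> \<theta> * h 1 + (1 - \<theta>) * h 0"
proof -
  have cont: "continuous_on {0..1} h"
    by (rule DERIV_continuous_on) (rule deriv)
  have deriv': "(h has_derivative (\<lambda>y. h' t * y)) (at t)" if "0 < t" "t < 1" for t
    using deriv[of t] that by (simp add: at_within_Icc_at has_field_derivative_def)
  obtain a where a: "0 < a" "a < \<theta>" "h \<theta> - h 0 = h' a * (\<theta> - 0)"
    using mvt[of 0 \<theta> h "\<lambda>t y. h' t * y"] deriv' \<theta> continuous_on_subset[OF cont, of "{0..\<theta>}"]
    by auto
  obtain b where b: "\<theta> < b" "b < 1" "h 1 - h \<theta> = h' b * (1 - \<theta>)"
    using mvt[of \<theta> 1 h "\<lambda>t y. h' t * y"] deriv' \<theta> continuous_on_subset[OF cont, of "{\<theta>..1}"]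
    by auto
  have "\<theta> * (1 - \<theta>) * h' a \<le> \<theta> * (1 - \<theta>) * h' b"
    using mono[of a b] a b \<theta> by (intro mult_left_mono) auto
  then have "(1 - \<theta>) * (h \<theta> - h 0) \<le> \<theta> * (h 1 - h \<theta>)"
    unfolding a(3) b(3) by (simp add: mult_ac)
  then show ?thesis
    by (simp add: algebra_simps)
qed

text \<open>
  The quadratic term subtracted from \<open>f\<close> on the segment has derivative \<open>\<sigma> t \<parallel>p - q\<parallel>\<^sup>2\<close>, which
  grows at the least rate that monotonicity allows for the derivative of \<open>f\<close>; the quadratic minus
  its own chord is the term \<open>- \<sigma>/2 \<theta> (1 - \<theta>) \<parallel>p - q\<parallel>\<^sup>2\<close>.
\<close>

lemma monotone_imp_strongly_convex:
  fixes f :: "'a::real_normed_vector \<Rightarrow> real"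
  assumes "convex C" "p \<in> C" "q \<in> C"
    and D: "\<And>x. x \<in> C \<Longrightarrow> (f has_derivative D x) (at x within C)"
    and mono: "\<And>x y. x \<in> C \<Longrightarrow> y \<in> C \<Longrightarrow> \<sigma> * (norm (x - y))\<^sup>2 \<le> D x (x - y) - D y (x - y)"
    and \<theta>: "0 < \<theta>" "\<theta> < 1"
  shows "f (\<theta> *\<^sub>R p + (1 - \<theta>) *\<^sub>R q)
    \<le> \<theta> * f p + (1 - \<theta>) * f q - \<sigma> / 2 * \<theta> * (1 - \<theta>) * (norm (p - q))\<^sup>2"
proof -
  let ?N = "(norm (p - q))\<^sup>2"
  let ?x = "\<lambda>t. q + t *\<^sub>R (p - q)"
  let ?h = "\<lambda>t. f (?x t) - \<sigma> / 2 * t\<^sup>2 * ?N"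
  let ?h' = "\<lambda>t. D (?x t) (p - q) - \<sigma> * t * ?N"
  note inC = segment_in_convex[OF assms(1-3)]
  have "?h \<theta> \<le> \<theta> * ?h 1 + (1 - \<theta>) * ?h 0"
  proof (rule below_chord_if_deriv_mono[where h' = ?h'])
    show "(?h has_real_derivative ?h' t) (at t within {0..1})" if "t \<in> {0..1}" for t
      by (rule derivative_eq_intros refl has_derivative_on_segment[OF assms(1-3) that D[OF inC[OF that]]])+
        simp
    show "?h' s \<le> ?h' t" if "0 < s" "s < t" "t < 1" for s t
    proof -
      have C: "?x s \<in> C" "?x t \<in> C"
        using that by (auto intro!: inC)
      have diff: "?x t - ?x s = (t - s) *\<^sub>R (p - q)"
        by (simp add: algebra_simps)
      have cancel: "(t - s) * (\<sigma> * N) \<le> A - B"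
        if "\<sigma> * ((t - s)\<^sup>2 * N) \<le> (t - s) * A - (t - s) * B" for A B N
      proof -
        have "(t - s) * ((t - s) * (\<sigma> * N)) \<le> (t - s) * (A - B)"
          using that by (simp add: power2_eq_square algebra_simps)
        then show ?thesis
          using \<open>s < t\<close> by (simp only: mult_le_cancel_left_pos diff_gt_0_iff_gt)
      qed
      have scale: "D x ((t - s) *\<^sub>R (p - q)) = (t - s) * D x (p - q)" if "x \<in> C" for x
        using linear_scale[OF has_derivative_linear[OF D[OF that]]] by simp
      have "(t - s) * (\<sigma> * ?N) \<le> D (?x t) (p - q) - D (?x s) (p - q)"
        using mono[OF C(2,1)]
        unfolding diff scale[OF C(1)] scale[OF C(2)] norm_scaleR power_mult_distrib power2_abs
        by (rule cancel)
      then show ?thesis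
        by (simp add: algebra_simps)
    qed
  qed (use \<theta> in auto)
  moreover have "?x \<theta> = \<theta> *\<^sub>R p + (1 - \<theta>) *\<^sub>R q"
    by (simp add: algebra_simps)
  ultimately show ?thesis
    by (simp add: algebra_simps power2_eq_square diff_divide_distrib)
qed

theorem mainTheorem5:
  fixes C :: "(quat ^ 'n) set" and f :: "quat ^ 'n \<Rightarrow> real" and \<sigma> :: real
  assumes "convex C" and "real_differentiable_on f C" and "\<sigma> > 0"
  shows "strongly_convex_on \<sigma> C f \<longleftrightarrow>
    (\<forall>p\<in>C. \<forall>q\<in>C.
      qa (hprod (quat_grad f p - quat_grad f q) (p - q)) \<ge> \<sigma> / 4 * (norm (p - q))\<^sup>2)"
proof -
  obtain D where D: "\<And>x. x \<in> C \<Longrightarrow> (f has_derivative D x) (at x within C)"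
    using assms(2) unfolding real_differentiable_on_def differentiable_def by metis
  have grad: "quat_grad f x \<bullet> v = D x v / 4" if "x \<in> C" for x v
    using assms(2) that by (intro inner_quat_grad[OF D]) (auto simp: real_differentiable_on_def)
  have mono_iff: "\<sigma> / 4 * (norm (p - q))\<^sup>2 \<le> qa (hprod (quat_grad f p - quat_grad f q) (p - q))
      \<longleftrightarrow> \<sigma> * (norm (p - q))\<^sup>2 \<le> D p (p - q) - D q (p - q)" if "p \<in> C" "q \<in> C" for p q
    using that by (auto simp: qa_hprod inner_diff_left grad)
  show ?thesis
  proof
    assume sc: "strongly_convex_on \<sigma> C f"
    have tangent: "f q + D q (p - q) + \<sigma> / 2 * (norm (p - q))\<^sup>2 \<le> f p" if "p \<in> C" "q \<in> C" for p q
      using sc that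
      by (intro strongly_convex_above_tangent[OF assms(1) that D]) (auto simp: strongly_convex_on_def)
    have "\<sigma> * (norm (p - q))\<^sup>2 \<le> D p (p - q) - D q (p - q)" if "p \<in> C" "q \<in> C" for p q
    proof -
      have "D p (q - p) = - D p (p - q)"
        using linear_neg[OF has_derivative_linear[OF D[OF that(1)]], of "p - q"] by simp
      then show ?thesis
        using tangent[OF that] tangent[OF that(2,1)] by (simp add: norm_minus_commute)
    qed
    then show "\<forall>p\<in>C. \<forall>q\<in>C.
        qa (hprod (quat_grad f p - quat_grad f q) (p - q)) \<ge> \<sigma> / 4 * (norm (p - q))\<^sup>2"
      using mono_iff by blast
  next
    assume "\<forall>p\<in>C. \<forall>q\<in>C.
        qa (hprod (quat_grad f p - quat_grad f q) (p - q)) \<ge> \<sigma> / 4 * (norm (p - q))\<^sup>2"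
    then have mono: "\<sigma> * (norm (x - y))\<^sup>2 \<le> D x (x - y) - D y (x - y)"
      if "x \<in> C" "y \<in> C" for x y
      using mono_iff that by blast
    show "strongly_convex_on \<sigma> C f"
      unfolding strongly_convex_on_def
    proof (intro ballI)
      fix p q and \<theta> :: real
      assume "p \<in> C" "q \<in> C" "\<theta> \<in> {0<..<1}"
      then show "f (\<theta> *\<^sub>R p + (1 - \<theta>) *\<^sub>R q)
          \<le> \<theta> * f p + (1 - \<theta>) * f q - \<sigma> / 2 * \<theta> * (1 - \<theta>) * (norm (p - q))\<^sup>2"
        using monotone_imp_strongly_convex[OF assms(1) _ _ D mono] by simp
    qed
  qed
qed

end
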